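(* Let $S=\langle f_1,f_2,\ldots,f_n\rangle$ be a finitely generated nearly abelian transcendental semigroup whose set of commutators $\Phi(S)$ is pre-compact, and suppose every commutator of $S$ is a map of the form $z\mapsto az+b$ with $a,b\in\mathbb{C}$, $a\neq 0$. Let $\phi\in\Phi(S)$ be a commutator of two of the generators, i.e. $\phi=[f_i,f_j]$ and $\phi^{-1}=[f_j,f_i]$ for some $i,j$, and let $$S'=\langle \phi\circ f_1\circ\phi^{-1},\ \phi\circ f_2\circ\phi^{-1},\ \ldots,\ \phi\circ f_n\circ\phi^{-1}\rangle$$ be the corresponding conjugate semigroup of $S$. Then $$\phi(I(S))=I(S'),\qquad \phi(J(S))=J(S'),\qquad \phi(F(S))=F(S').$$
   Context: A transcendental semigroup $S=\langle f_\alpha\rangle_{\alpha\in\Delta}$ is the set of all finite compositions $f_{\alpha_1}\circ\cdots\circ f_{\alpha_m}$ ($m\ge 1$) of members of a family $\{f_\alpha\}$ of transcendental entire functions $\mathbb{C}\to\mathbb{C}$ (the generators). $f^n$ denotes the $n$-th iterate of $f$. Fatou, Julia and escaping sets: $S$ is normal on a domain $D$ if every sequence of elements of $S$ has a subsequence which either converges uniformly on all compact subsets of $D$ or diverges to $\infty$ uniformly on all compact subsets of $D$. $F(S)$ is the set of $z\in\mathbb{C}$ such that $S$ is normal in some neighbourhood of $z$; $J(S)=\mathbb{C}\setminus F(S)$; $I(S)=\{z\in\mathbb{C}: f^n(z)\to\infty \text{ as } n\to\infty \text{ for every } f\in S\}$. Nearly abelian: $S$ is nearly abelian if there is a family $\Phi=\{\phi_i\}$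 of conformal maps $\mathbb{C}\to\mathbb{C}$ (bijective and holomorphic) such that (1) $\phi_i(F(S))=F(S)$ for all $\phi_i\in\Phi$, and (2) for all $f,g\in S$ there is $\phi\in\Phi$ with $f\circ g=\phi\circ g\circ f$. Commutators: $\Phi(S)$ is the set of entire functions $\phi$ for which there are $f,g\in S$ with $f\circ g=\phi\circ g\circ f$; one then writes $\phi=[f,g]$ (it is uniquely determined by $f$ and $g$). $\Phi(S)$ is pre-compact if every sequence in $\Phi(S)$ has a subsequence converging uniformly on $\mathbb{C}$ to a non-constant holomorphic function. *)

theory Defs
  imports "HOL-Complex_Analysis.Complex_Analysis"
begin

definition transcendental_entire :: "(complex \<Rightarrow> complex) \<Rightarrow> bool" where
  "transcendental_entire f \<longleftrightarrow> f holomorphic_on UNIV \<and> (\<nexists>p. f = poly p)"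

inductive_set comp_semigroup :: "(complex \<Rightarrow> complex) set \<Rightarrow> (complex \<Rightarrow> complex) set"
  for G :: "(complex \<Rightarrow> complex) set"
where
  gen: "g \<in> G \<Longrightarrow> g \<in> comp_semigroup G"
| comp: "g \<in> G \<Longrightarrow> h \<in> comp_semigroup G \<Longrightarrow> g \<circ> h \<in> comp_semigroup G"

definition unif_diverges_on :: "complex set \<Rightarrow> (nat \<Rightarrow> complex \<Rightarrow> complex) \<Rightarrow> bool" where
  "unif_diverges_on K s \<longleftrightarrow> (\<forall>B::real. \<forall>\<^sub>F k in sequentially. \<forall>z\<in>K. B \<le> norm (s k z))"

text \<open>The limit function of a locally uniformly convergent subsequence is not required to lie in
  the family; it is automatically holomorphic when the members of the family are.\<close>

definition normal_on :: "(complex \<Rightarrow> complex) set \<Rightarrow> complex set \<Rightarrow> bool" where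
  "normal_on S D \<longleftrightarrow>
     (\<forall>s :: nat \<Rightarrow> complex \<Rightarrow> complex. range s \<subseteq> S \<longrightarrow>
        (\<exists>r :: nat \<Rightarrow> nat. strict_mono r \<and>
           ((\<exists>g. \<forall>K. compact K \<and> K \<subseteq> D \<longrightarrow> uniform_limit K (s \<circ> r) g sequentially) \<or>
            (\<forall>K. compact K \<and> K \<subseteq> D \<longrightarrow> unif_diverges_on K (s \<circ> r)))))"

definition fatou_set :: "(complex \<Rightarrow> complex) set \<Rightarrow> complex set" where
  "fatou_set S = {z. \<exists>D. open D \<and> connected D \<and> z \<in> D \<and> normal_on S D}"

definition julia_set :: "(complex \<Rightarrow> complex) set \<Rightarrow> complex set" where
  "julia_set S = - fatou_set S"

definition escaping_set :: "(complex \<Rightarrow> complex) set \<Rightarrow> complex set" where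
  "escaping_set S = {z. \<forall>f\<in>S. filterlim (\<lambda>n. (f ^^ n) z) at_infinity sequentially}"

definition conformal_auto :: "(complex \<Rightarrow> complex) \<Rightarrow> bool" where
  "conformal_auto \<phi> \<longleftrightarrow> bij \<phi> \<and> \<phi> holomorphic_on UNIV"

definition nearly_abelian :: "(complex \<Rightarrow> complex) set \<Rightarrow> bool" where
  "nearly_abelian S \<longleftrightarrow>
     (\<exists>\<Phi>. (\<forall>\<phi>\<in>\<Phi>. conformal_auto \<phi> \<and> \<phi> ` fatou_set S = fatou_set S) \<and>
          (\<forall>f\<in>S. \<forall>g\<in>S. \<exists>\<phi>\<in>\<Phi>. f \<circ> g = \<phi> \<circ> g \<circ> f))"

text \<open>The relation \<open>\<phi> = [f, g]\<close>. For non-constant entire \<open>f\<close> and \<open>g\<close> at most one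
  \<open>\<phi>\<close> satisfies it, by the identity theorem on the range of \<open>g \<circ> f\<close>.\<close>

definition is_commutator ::
  "(complex \<Rightarrow> complex) \<Rightarrow> (complex \<Rightarrow> complex) \<Rightarrow> (complex \<Rightarrow> complex) \<Rightarrow> bool" where
  "is_commutator \<phi> f g \<longleftrightarrow> \<phi> holomorphic_on UNIV \<and> f \<circ> g = \<phi> \<circ> g \<circ> f"

definition commutators :: "(complex \<Rightarrow> complex) set \<Rightarrow> (complex \<Rightarrow> complex) set" where
  "commutators S = {\<phi>. \<exists>f\<in>S. \<exists>g\<in>S. is_commutator \<phi> f g}"

text \<open>Convergence is uniform on all of \<open>\<complex>\<close>, not merely on compact subsets.\<close>

definition pre_compact :: "(complex \<Rightarrow> complex) set \<Rightarrow> bool" where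
  "pre_compact \<Phi> \<longleftrightarrow>
     (\<forall>s :: nat \<Rightarrow> complex \<Rightarrow> complex. range s \<subseteq> \<Phi> \<longrightarrow>
        (\<exists>(r :: nat \<Rightarrow> nat) g. strict_mono r \<and> g holomorphic_on UNIV \<and> \<not> g constant_on UNIV \<and>
           uniform_limit UNIV (s \<circ> r) g sequentially))"

end

theory Submission
  imports Defs
begin

text \<open>The commutator \<open>\<phi>\<close> is affine with nonzero slope, hence a bijection of
  the plane, and S' is the image of S under h \<mapsto> \<phi> h \<phi>^{-1}, since conjugation
  respects composition (\<open>comp_semigroup_conjugate\<close>). Affine maps are uniformly
  continuous on the whole plane and send infinity to infinity, so they transport locally uniform
  limits, uniform divergence and escaping orbits. This gives one inclusion for Fatou and for
  escaping sets, for every affine map and every family S. Applying that inclusion to \<phi>^{-1} and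
  the conjugated family reverses it (\<open>conjugation_equivariant_if_subset\<close>); Julia sets
  follow by complements.\<close>

definition conjugate :: "('a \<Rightarrow> 'a) \<Rightarrow> ('a \<Rightarrow> 'a) \<Rightarrow> 'a \<Rightarrow> 'a" where
  "conjugate \<phi> h = \<phi> \<circ> h \<circ> inv \<phi>"

lemma conjugate_comp:
  assumes "bij \<phi>"
  shows "conjugate \<phi> (g \<circ> h) = conjugate \<phi> g \<circ> conjugate \<phi> h"
  using assms by (simp add: conjugate_def fun_eq_iff bij_is_inj)

lemma conjugate_inv_conjugate:
  assumes "bij \<phi>"
  shows "conjugate (inv \<phi>) (conjugate \<phi> h) = h"
  using assms by (simp add: conjugate_def fun_eq_iff bij_is_inj inv_inv_eq)

text \<open>The inner factors \<phi>^{-1} \<phi> cancel in an iterate. Evaluating at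
  \<open>\<phi> z\<close> also absorbs the innermost inverse.\<close>

lemma conjugate_funpow:
  assumes "bij \<phi>"
  shows "(conjugate \<phi> h ^^ n) (\<phi> z) = \<phi> ((h ^^ n) z)"
  using assms by (induction n) (simp_all add: conjugate_def bij_is_inj)

text \<open>Conjugation by a bijection is a homomorphism for composition, so words in the conjugated
  generators are exactly the conjugates of words in the generators; each inclusion is an induction
  on the word.\<close>

lemma comp_semigroup_conjugate:
  assumes "bij \<phi>"
  shows "comp_semigroup (conjugate \<phi> ` G) = conjugate \<phi> ` comp_semigroup G"
proof (intro equalityI subsetI)
  fix h assume "h \<in> comp_semigroup (conjugate \<phi> ` G)"
  then show "h \<in> conjugate \<phi> ` comp_semigroup G"
  proof induction
    case (gen g)
    then show ?case by (auto intro: comp_semigroup.gen)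
  next
    case (comp g h)
    then obtain g' h' where "g' \<in> G" "g = conjugate \<phi> g'"
      "h' \<in> comp_semigroup G" "h = conjugate \<phi> h'" by auto
    then show ?case
      using conjugate_comp[OF assms, of g' h'] comp_semigroup.comp by (metis image_eqI)
  qed
next
  fix h assume "h \<in> conjugate \<phi> ` comp_semigroup G"
  then obtain h' where "h' \<in> comp_semigroup G" "h = conjugate \<phi> h'" by auto
  moreover from this(1) have "conjugate \<phi> h' \<in> comp_semigroup (conjugate \<phi> ` G)"
    by induction (simp_all add: conjugate_comp[OF assms] comp_semigroup.intros del: o_apply)
  ultimately show "h \<in> comp_semigroup (conjugate \<phi> ` G)" by simp
qed

definition complex_affine :: "(complex \<Rightarrow> complex) \<Rightarrow> bool" where
  "complex_affine \<phi> \<longleftrightarrow> (\<exists>a b. a \<noteq> 0 \<and> \<phi> = (\<lambda>z. a * z + b))"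

lemma complex_affine_bij:
  assumes "complex_affine \<phi>"
  shows "bij \<phi>"
proof -
  obtain a b where ab: "a \<noteq> 0" "\<phi> = (\<lambda>z. a * z + b)"
    using assms by (auto simp: complex_affine_def)
  then show ?thesis
    by (intro o_bij[where g = "\<lambda>z. (z - b) / a"]) (auto simp: fun_eq_iff)
qed

lemma complex_affine_inv:
  assumes "complex_affine \<phi>"
  shows "complex_affine (inv \<phi>)"
proof -
  obtain a b where ab: "a \<noteq> 0" "\<phi> = (\<lambda>z. a * z + b)"
    using assms by (auto simp: complex_affine_def)
  then have "inv \<phi> = (\<lambda>z. (1 / a) * z + - b / a)"
    by (intro inv_equality) (auto simp: field_simps)
  with ab(1) show ?thesis
    unfolding complex_affine_def by (intro exI[of _ "1 / a"] exI[of _ "- b / a"]) auto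
qed

lemma complex_affine_continuous_on: "complex_affine \<phi> \<Longrightarrow> continuous_on X \<phi>"
  by (auto simp: complex_affine_def intro!: continuous_intros)

lemma complex_affine_uniformly_continuous_on: "complex_affine \<phi> \<Longrightarrow> uniformly_continuous_on X \<phi>"
  by (auto simp: complex_affine_def intro!: uniformly_continuous_on_add
      uniformly_continuous_on_cmul_left uniformly_continuous_on_id uniformly_continuous_on_const)

lemma complex_affine_filterlim_at_infinity:
  "complex_affine \<phi> \<Longrightarrow> filterlim \<phi> at_infinity at_infinity"
  by (auto simp: complex_affine_def intro!: tendsto_add_filterlim_at_infinity'
      tendsto_mult_filterlim_at_infinity filterlim_ident tendsto_const)

text \<open>A sequence of conjugates is pulled back to a sequence \<open>t\<close> in S. The
  subsequence that normality gives for \<open>t\<close> also serves for \<open>s\<close>, with the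
  same alternative of convergence or divergence.\<close>

lemma normal_on_conjugate:
  assumes \<phi>: "complex_affine \<phi>" and normal: "normal_on S D"
  shows "normal_on (conjugate \<phi> ` S) (\<phi> ` D)"
  unfolding normal_on_def
proof (intro allI impI)
  fix s :: "nat \<Rightarrow> complex \<Rightarrow> complex"
  assume "range s \<subseteq> conjugate \<phi> ` S"
  then have "\<forall>k. \<exists>h\<in>S. s k = conjugate \<phi> h" by auto
  then obtain t where t: "\<And>k. t k \<in> S" "\<And>k. s k = conjugate \<phi> (t k)" by metis
  then obtain r where r: "strict_mono r" and
    cases: "(\<exists>g. \<forall>K. compact K \<and> K \<subseteq> D \<longrightarrow> uniform_limit K (t \<circ> r) g sequentially) \<or>
      (\<forall>K. compact K \<and> K \<subseteq> D \<longrightarrow> unif_diverges_on K (t \<circ> r))"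
    using normal unfolding normal_on_def by (metis image_subsetI)
  \<comment> \<open>Compact subsets of the image domain pull back to compact subsets of
    \<open>D\<close>, where normality of S applies.\<close>
  have pull: "compact (inv \<phi> ` K) \<and> inv \<phi> ` K \<subseteq> D" if "compact K \<and> K \<subseteq> \<phi> ` D" for K
    using that complex_affine_bij[OF \<phi>] complex_affine_continuous_on[OF complex_affine_inv[OF \<phi>]]
    by (auto intro!: compact_continuous_image simp: bij_is_inj)
  from cases show "\<exists>r. strict_mono r \<and>
     ((\<exists>g. \<forall>K. compact K \<and> K \<subseteq> \<phi> ` D \<longrightarrow> uniform_limit K (s \<circ> r) g sequentially) \<or>
      (\<forall>K. compact K \<and> K \<subseteq> \<phi> ` D \<longrightarrow> unif_diverges_on K (s \<circ> r)))"
  proof (elim disjE exE)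
    fix g assume g: "\<forall>K. compact K \<and> K \<subseteq> D \<longrightarrow> uniform_limit K (t \<circ> r) g sequentially"
    have "uniform_limit K (s \<circ> r) (\<phi> \<circ> g \<circ> inv \<phi>) sequentially"
      if K: "compact K \<and> K \<subseteq> \<phi> ` D" for K
    proof -
      \<comment> \<open>Uniform continuity of \<open>\<phi>\<close> on the whole plane lets
        \<open>B = UNIV\<close> serve as the set containing all values, so no bound on the values of
        \<open>t\<close> or \<open>g\<close> is required.\<close>
      have "uniform_limit (inv \<phi> ` K) (\<lambda>k z. \<phi> ((t \<circ> r) k z)) (\<lambda>z. \<phi> (g z)) sequentially"
        using g[rule_format, OF pull[OF K]] complex_affine_uniformly_continuous_on[OF \<phi>]
        by (rule uniform_limit_compose_uniformly_continuous_on[where B = UNIV]) auto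
      then show ?thesis
        by (simp add: uniform_limit_iff t(2) conjugate_def)
    qed
    with r show ?thesis by blast
  next
    assume div: "\<forall>K. compact K \<and> K \<subseteq> D \<longrightarrow> unif_diverges_on K (t \<circ> r)"
    have "unif_diverges_on K (s \<circ> r)" if K: "compact K \<and> K \<subseteq> \<phi> ` D" for K
      unfolding unif_diverges_on_def
    proof
      fix B :: real
      \<comment> \<open>Since \<open>\<phi>\<close> tends to infinity at infinity, the bound
        \<open>B\<close> after applying \<open>\<phi>\<close> is guaranteed by some bound
        \<open>C\<close> before it, uniformly in the point.\<close>
      have "\<forall>\<^sub>F z in at_infinity. B \<le> norm (\<phi> z)"
        using filterlim_at_infinity_imp_norm_at_top[OF complex_affine_filterlim_at_infinity[OF \<phi>]]
        by (simp add: filterlim_at_top)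
      then obtain C where C: "\<And>z. C \<le> norm z \<Longrightarrow> B \<le> norm (\<phi> z)"
        by (auto simp: eventually_at_infinity)
      have "\<forall>\<^sub>F k in sequentially. \<forall>z\<in>inv \<phi> ` K. C \<le> norm ((t \<circ> r) k z)"
        using div pull[OF K] by (auto simp: unif_diverges_on_def)
      then show "\<forall>\<^sub>F k in sequentially. \<forall>z\<in>K. B \<le> norm ((s \<circ> r) k z)"
        by eventually_elim (auto simp: t(2) conjugate_def intro!: C)
    qed
    with r show ?thesis by blast
  qed
qed

lemma fatou_set_conjugate_subset:
  assumes \<phi>: "complex_affine \<phi>"
  shows "\<phi> ` fatou_set S \<subseteq> fatou_set (conjugate \<phi> ` S)"
proof
  fix w assume "w \<in> \<phi> ` fatou_set S"
  then obtain z D where D: "w = \<phi> z" "open D" "connected D" "z \<in> D" "normal_on S D"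
    by (auto simp: fatou_set_def)
  \<comment> \<open>Rewriting the image as a preimage under the continuous inverse makes its
    openness immediate.\<close>
  have "\<phi> ` D = inv \<phi> -` D"
    using bij_vimage_eq_inv_image[OF bij_imp_bij_inv] complex_affine_bij[OF \<phi>]
    by (metis inv_inv_eq)
  then have "open (\<phi> ` D)"
    using D(2) complex_affine_continuous_on[OF complex_affine_inv[OF \<phi>]]
    by (simp add: open_vimage)
  moreover have "connected (\<phi> ` D)"
    using D(3) complex_affine_continuous_on[OF \<phi>] by (rule connected_continuous_image[rotated])
  ultimately show "w \<in> fatou_set (conjugate \<phi> ` S)"
    using D normal_on_conjugate[OF \<phi> D(5)] unfolding fatou_set_def by blast
qed

text \<open>The orbit of \<open>\<phi> z\<close> under a conjugate is the
  \<open>\<phi>\<close>-image of the orbit of \<open>z\<close>, and \<open>\<phi>\<close> preserves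
  convergence to infinity.\<close>

lemma escaping_set_conjugate_subset:
  assumes \<phi>: "complex_affine \<phi>"
  shows "\<phi> ` escaping_set S \<subseteq> escaping_set (conjugate \<phi> ` S)"
proof -
  have "filterlim (\<lambda>n. \<phi> ((h ^^ n) z)) at_infinity sequentially"
    if "filterlim (\<lambda>n. (h ^^ n) z) at_infinity sequentially"
    for h :: "complex \<Rightarrow> complex" and z
    using complex_affine_filterlim_at_infinity[OF \<phi>] that by (rule filterlim_compose)
  then show ?thesis
    by (auto simp: escaping_set_def conjugate_funpow[OF complex_affine_bij[OF \<phi>]])
qed

text \<open>The inclusion is assumed for all affine maps and all families so that it can also be
  used for \<phi>^{-1} and the conjugated family; conjugating back recovers S, and applying
  \<open>\<phi>\<close> gives the reverse inclusion. \<open>X\<close> stands for the Fatou or the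
  escaping set.\<close>

lemma conjugation_equivariant_if_subset:
  assumes sub: "\<And>\<phi> S. complex_affine \<phi> \<Longrightarrow> \<phi> ` X S \<subseteq> X (conjugate \<phi> ` S)"
    and \<phi>: "complex_affine \<phi>"
  shows "\<phi> ` X S = X (conjugate \<phi> ` S)"
proof
  have bij: "bij \<phi>" using \<phi> by (rule complex_affine_bij)
  have "inv \<phi> ` X (conjugate \<phi> ` S) \<subseteq> X S"
    using sub[OF complex_affine_inv[OF \<phi>], of "conjugate \<phi> ` S"]
    by (simp add: image_image conjugate_inv_conjugate[OF bij])
  then have "\<phi> ` inv \<phi> ` X (conjugate \<phi> ` S) \<subseteq> \<phi> ` X S" by (rule image_mono)
  then show "X (conjugate \<phi> ` S) \<subseteq> \<phi> ` X S"
    by (simp add: image_f_inv_f bij_is_surj[OF bij])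
qed (rule sub[OF \<phi>])

theorem theorem1p1:
  fixes n :: nat
    and f :: "nat \<Rightarrow> complex \<Rightarrow> complex"
    and S S' :: "(complex \<Rightarrow> complex) set"
    and \<phi> :: "complex \<Rightarrow> complex"
    and i j :: nat
  assumes "\<And>k. k \<in> {1..n} \<Longrightarrow> transcendental_entire (f k)"
    and "S = comp_semigroup (f ` {1..n})"
    and "nearly_abelian S"
    and "pre_compact (commutators S)"
    and "\<And>\<psi>. \<psi> \<in> commutators S \<Longrightarrow> \<exists>a b. a \<noteq> 0 \<and> \<psi> = (\<lambda>z. a * z + b)"
    and "\<phi> \<in> commutators S"
    and "i \<in> {1..n}" and "j \<in> {1..n}"
    and "is_commutator \<phi> (f i) (f j)"
    and "is_commutator (inv \<phi>) (f j) (f i)"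
    and "S' = comp_semigroup ((\<lambda>k. \<phi> \<circ> f k \<circ> inv \<phi>) ` {1..n})"
  shows "\<phi> ` escaping_set S = escaping_set S' \<and>
         \<phi> ` julia_set S = julia_set S' \<and>
         \<phi> ` fatou_set S = fatou_set S'"
proof -
  have \<phi>: "complex_affine \<phi>"
    using assms(5)[OF assms(6)] by (simp add: complex_affine_def)
  then have bij: "bij \<phi>" by (rule complex_affine_bij)
  have S': "S' = conjugate \<phi> ` S"
    using comp_semigroup_conjugate[OF bij, of "f ` {1..n}"] assms(2,11)
    by (simp add: image_image conjugate_def)
  have "\<phi> ` fatou_set S = fatou_set S'"
    unfolding S' using fatou_set_conjugate_subset \<phi> by (rule conjugation_equivariant_if_subset)
  \<comment> \<open>A bijection commutes with complements, so the Fatou equality transfers.\<close>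
  moreover from this have "\<phi> ` julia_set S = julia_set S'"
    using bij_image_Compl_eq[OF bij] by (simp add: julia_set_def)
  moreover have "\<phi> ` escaping_set S = escaping_set S'"
    unfolding S' using escaping_set_conjugate_subset \<phi> by (rule conjugation_equivariant_if_subset)
  ultimately show ?thesis by blast
qed

end
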